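(* Let $M$ be a free $\mathbb{Z}$-module of rank $n$, let $M_{\mathbb{R}}=M\otimes_{\mathbb{Z}}\mathbb{R}$, and let $P\subset M_{\mathbb{R}}$ be an $n$-dimensional lattice simplex with lattice length $l(P)$. (a) If $n=3$ and $l(P)\ge 2$, then $P$ can be covered by dilations of the form $sQ$ with $s\ge 2$ an integer and $Q$ a lattice simplex; that is, there exist finitely many lattice simplices $Q_i$, integers $s_i\ge 2$ and vectors $w_i\in M$ such that $P=\bigcup_i (w_i+s_iQ_i)$. (b) If $n=4$, $l(P)\ge 3$, and no edge of $P$ has lattice length $5$, then $P$ can be covered by dilations of the form $sQ$ with $s\ge 3$ an integer and $Q$ a lattice simplex; that is, there exist finitely many lattice simplices $Q_i$, integers $s_i\ge 3$ and vectors $w_i\in M$ such that $P=\bigcup_i (w_i+s_iQ_i)$.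
   Context: A lattice polytope in $M_{\mathbb{R}}$ is the convex hull of finitely many points of $M$; all polytopes (in particular $P$ and the $Q_i$) are assumed to be full-dimensional. A lattice simplex is a lattice polytope that is a simplex. For an integer $s\ge 1$, $sQ=\{su : u\in Q\}$; "a dilation of the form $sQ$" is understood up to translation by an element of $M$. The lattice length of an edge $e$ of a lattice polytope is the number of points of $M$ on $e$ (endpoints included) minus $1$. The lattice length $l(P)$ of $P$ is the minimum of the lattice lengths of all edges of $P$. *)

theory Defs
  imports "HOL-Analysis.Analysis"
begin

(* A free Z-module M of rank n = DIM('a), sitting inside the real vector space 'a = M (x) R:
   a Z-basis of M is at the same time an R-basis of 'a.  The Euclidean structure of 'a plays no
   role in what follows. *)
definition full_rank_lattice :: "'a::euclidean_space set \<Rightarrow> bool" where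
  "full_rank_lattice M \<longleftrightarrow>
     (\<exists>B. independent B \<and> span B = UNIV \<and>
          M = range (\<lambda>c :: 'a \<Rightarrow> int. \<Sum>b\<in>B. of_int (c b) *\<^sub>R b))"

definition lattice_polytope :: "'a::euclidean_space set \<Rightarrow> 'a set \<Rightarrow> bool" where
  "lattice_polytope M P \<longleftrightarrow> (\<exists>V. finite V \<and> V \<subseteq> M \<and> P = convex hull V)"

(* All polytopes are full-dimensional by convention, so the simplex has dimension DIM('a). *)
definition lattice_simplex :: "'a::euclidean_space set \<Rightarrow> 'a set \<Rightarrow> bool" where
  "lattice_simplex M P \<longleftrightarrow> lattice_polytope M P \<and> int DIM('a) simplex P"

definition edge_lattice_length :: "'a::euclidean_space set \<Rightarrow> 'a set \<Rightarrow> nat" where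
  "edge_lattice_length M e = card (e \<inter> M) - 1"

definition lattice_length :: "'a::euclidean_space set \<Rightarrow> 'a set \<Rightarrow> nat" where
  "lattice_length M P = Min (edge_lattice_length M ` {e. e edge_of P})"

definition covered_by_dilations :: "'a::euclidean_space set \<Rightarrow> nat \<Rightarrow> 'a set \<Rightarrow> bool" where
  "covered_by_dilations M k P \<longleftrightarrow>
     (\<exists>F :: ('a \<times> nat \<times> 'a set) set. finite F \<and>
        (\<forall>(w, s, Q)\<in>F. w \<in> M \<and> s \<ge> k \<and> lattice_simplex M Q) \<and>
        P = (\<Union>(w, s, Q)\<in>F. (\<lambda>u. w + real s *\<^sub>R u) ` Q))"

end

(* Cut P into the regions where a fixed vertex v has the largest barycentric coordinate, and cover
   the region of v by dilated simplices with a corner at v: shorten every edge at v, of lattice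
   length l, to the largest multiple of s. This corner contains every point whose coordinate at v is
   at least the sum of the other coordinates weighted by (l mod s) / (l - l mod s), so it contains
   the whole region of v as soon as these weights sum to at most 1.
   In dimension 3, s = 2 works unless at least two of the lengths are 3 and the third is odd, and then
   s = 3 works. In dimension 4, s = 3 or s = 4 works except for lengths 7, 11 and twice 4 or 8, where
   the corner with s = 3 and one lattice translate of it suffice. *)
theory Submission
  imports Defs
begin

section \<open>Lattice points on lines and segments\<close>

lemma lattice_zero: "full_rank_lattice M \<Longrightarrow> 0 \<in> M"
  unfolding full_rank_lattice_def by (auto intro!: range_eqI[where x="\<lambda>_. 0"])

lemma lattice_add:
  assumes "full_rank_lattice M" "x \<in> M" "y \<in> M"
  shows "x + y \<in> M"
proof -
  obtain B where M: "M = range (\<lambda>c :: 'a \<Rightarrow> int. \<Sum>b\<in>B. of_int (c b) *\<^sub>R b)"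
    using assms(1) unfolding full_rank_lattice_def by blast
  obtain c d :: "'a \<Rightarrow> int" where "x = (\<Sum>b\<in>B. of_int (c b) *\<^sub>R b)" "y = (\<Sum>b\<in>B. of_int (d b) *\<^sub>R b)"
    using assms(2,3) M by auto
  then have "x + y = (\<Sum>b\<in>B. of_int (c b + d b) *\<^sub>R b)"
    by (simp add: scaleR_add_left sum.distrib)
  then show ?thesis unfolding M by (rule range_eqI[where x="\<lambda>b. c b + d b"])
qed

lemma lattice_scale_int:
  assumes "full_rank_lattice M" "x \<in> M"
  shows "of_int k *\<^sub>R x \<in> M"
proof -
  obtain B where M: "M = range (\<lambda>c :: 'a \<Rightarrow> int. \<Sum>b\<in>B. of_int (c b) *\<^sub>R b)"
    using assms(1) unfolding full_rank_lattice_def by blast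
  obtain c :: "'a \<Rightarrow> int" where "x = (\<Sum>b\<in>B. of_int (c b) *\<^sub>R b)"
    using assms(2) M by auto
  then have "of_int k *\<^sub>R x = (\<Sum>b\<in>B. of_int (k * c b) *\<^sub>R b)"
    by (simp add: scaleR_sum_right)
  then show ?thesis unfolding M by (rule range_eqI[where x="\<lambda>b. k * c b"])
qed

lemma lattice_scale_nat:
  assumes "full_rank_lattice M" "x \<in> M"
  shows "of_nat k *\<^sub>R x \<in> M"
  using lattice_scale_int[OF assms, of "int k"] by simp

lemma lattice_diff:
  assumes "full_rank_lattice M" "x \<in> M" "y \<in> M"
  shows "x - y \<in> M"
  using lattice_add[OF assms(1,2) lattice_scale_int[OF assms(1,3), of "-1"]] by simp

text \<open>The witness \<open>g\<close> is the gcd of the coordinates of \<open>d\<close> in a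
  basis of \<open>M\<close>: \<open>d\<close> is \<open>g\<close> times a primitive lattice vector,
  and the lattice points on its line are the integer multiples of that vector.\<close>

lemma lattice_multiples:
  assumes "full_rank_lattice M" "d \<in> M" "d \<noteq> 0"
  obtains g :: nat where "g > 0" "\<And>t. t *\<^sub>R d \<in> M \<longleftrightarrow> t * real g \<in> \<int>"
proof -
  obtain B where B: "independent B"
    and M: "M = range (\<lambda>c :: 'a \<Rightarrow> int. \<Sum>b\<in>B. of_int (c b) *\<^sub>R b)"
    using assms(1) unfolding full_rank_lattice_def by blast
  have fin: "finite B" using B by (rule finiteI_independent)
  obtain c :: "'a \<Rightarrow> int" where d: "d = (\<Sum>b\<in>B. of_int (c b) *\<^sub>R b)"
    using assms(2) M by auto
  have coord: "t *\<^sub>R d \<in> M \<longleftrightarrow> (\<forall>b\<in>B. t * of_int (c b) \<in> \<int>)" (is "?l \<longleftrightarrow> ?r") for t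
  proof
    assume ?l
    then obtain e :: "'a \<Rightarrow> int" where "t *\<^sub>R d = (\<Sum>b\<in>B. of_int (e b) *\<^sub>R b)"
      using M by auto
    then have "(\<Sum>b\<in>B. (t * of_int (c b) - of_int (e b)) *\<^sub>R b) = 0"
      unfolding d by (simp add: scaleR_sum_right scaleR_diff_left sum_subtractf)
    then have "t * of_int (c b) - of_int (e b) = 0" if "b \<in> B" for b
      using independentD[OF B fin order_refl, where u="\<lambda>b. t * of_int (c b) - of_int (e b)"] that by blast
    then show ?r by (metis Ints_of_int eq_iff_diff_eq_0)
  next
    assume ?r
    then have "\<forall>b\<in>B. \<exists>k::int. t * of_int (c b) = of_int k" by (auto elim: Ints_cases)
    then obtain e :: "'a \<Rightarrow> int" where e: "\<And>b. b \<in> B \<Longrightarrow> t * of_int (c b) = of_int (e b)"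
      by metis
    have "t *\<^sub>R d = (\<Sum>b\<in>B. of_int (e b) *\<^sub>R b)"
      unfolding d scaleR_sum_right by (rule sum.cong) (simp_all add: e)
    then show ?l unfolding M by blast
  qed
  obtain b0 where b0: "b0 \<in> B" "c b0 \<noteq> 0"
  proof (rule ccontr)
    assume "\<not> thesis"
    then have "\<forall>b\<in>B. c b = 0" using that by blast
    then show False using assms(3) unfolding d by simp
  qed
  define G where "G = Gcd (c ` B)"
  have G0: "G > 0"
  proof -
    have "G \<noteq> 0" unfolding G_def using b0 by (auto simp: Gcd_0_iff)
    moreover have "G \<ge> 0" unfolding G_def by simp
    ultimately show ?thesis by simp
  qed
  have "t *\<^sub>R d \<in> M \<longleftrightarrow> t * of_int G \<in> \<int>" for t
  proof
    assume "t *\<^sub>R d \<in> M"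
    then have int: "\<And>b. b \<in> B \<Longrightarrow> t * of_int (c b) \<in> \<int>" using coord by blast
    then obtain k :: int where k: "t * of_int (c b0) = of_int k" using b0 Ints_cases by metis
    \<comment> \<open>Cross-multiplying the two integral products turns integrality into
      divisibility by \<open>c b0\<close>, which passes to the gcd.\<close>
    have "c b0 dvd k * c b" if b: "b \<in> B" for b
    proof -
      obtain m :: int where m: "t * of_int (c b) = of_int m" using int[OF b] Ints_cases by metis
      have "real_of_int (k * c b) = real_of_int (c b0 * m)"
        using k m by (simp add: mult.assoc mult.left_commute flip: k m)
      then show ?thesis by (metis dvd_triv_left of_int_eq_iff)
    qed
    then have "c b0 dvd Gcd ((*) k ` c ` B)" by (intro Gcd_greatest) auto
    then have "c b0 dvd k * G" by (simp add: Gcd_mult G_def)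
    then obtain m where "k * G = c b0 * m" by blast
    then have "of_int (c b0) * (t * of_int G) = of_int (c b0) * real_of_int m"
      by (metis k mult.assoc mult.commute of_int_mult)
    then have "t * of_int G = of_int m" using b0 by simp
    then show "t * of_int G \<in> \<int>" by simp
  next
    assume tG: "t * of_int G \<in> \<int>"
    have "t * of_int (c b) \<in> \<int>" if "b \<in> B" for b
    proof -
      have "G dvd c b" unfolding G_def using that by (intro Gcd_dvd) auto
      then obtain m where "c b = G * m" by blast
      then have "t * of_int (c b) = t * of_int G * of_int m" by simp
      then show ?thesis using tG by (metis Ints_mult Ints_of_int)
    qed
    then show "t *\<^sub>R d \<in> M" using coord by blast
  qed
  then show thesis using that[of "nat G"] G0 by simp
qed

text \<open>The points of \<open>M\<close> on the segment are \<open>a + (k / g) (b - a)\<close> for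
  \<open>k\<close> from 0 to the \<open>g\<close> of \<open>lattice_multiples\<close>. These are
  \<open>g + 1\<close> points, so the lattice length is \<open>g\<close>, and dividing the edge
  vector by it gives one lattice step.\<close>

lemma segment_lattice_length:
  assumes M: "full_rank_lattice M" and a: "a \<in> M" and b: "b \<in> M" and "a \<noteq> b"
  defines "l \<equiv> edge_lattice_length M (closed_segment a b)"
  shows "(1 / real l) *\<^sub>R (b - a) \<in> M"
proof -
  obtain g :: nat where g: "g > 0" "\<And>t. t *\<^sub>R (b - a) \<in> M \<longleftrightarrow> t * real g \<in> \<int>"
    using lattice_multiples[OF M lattice_diff[OF M b a]] \<open>a \<noteq> b\<close> by auto
  have "closed_segment a b \<inter> M = (\<lambda>k. a + (real k / real g) *\<^sub>R (b - a)) ` {..g}"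
  proof (intro equalityI subsetI)
    fix x assume x: "x \<in> closed_segment a b \<inter> M"
    then obtain t where t: "0 \<le> t" "t \<le> 1" "x = a + t *\<^sub>R (b - a)"
      by (auto simp: in_segment algebra_simps)
    then have "t *\<^sub>R (b - a) \<in> M" using lattice_diff[OF M _ a, of x] x by simp
    then obtain k :: int where k: "t * real g = of_int k" using g(2) Ints_cases by metis
    have "0 \<le> t * real g" "t * real g \<le> real g" using t by (auto simp: mult_left_le_one_le)
    then have "0 \<le> k" "k \<le> int g" using k by linarith+
    moreover have "t = of_int k / real g" using k g(1) by (simp add: field_simps)
    ultimately show "x \<in> (\<lambda>k. a + (real k / real g) *\<^sub>R (b - a)) ` {..g}"
      using t(3) by (intro image_eqI[of _ _ "nat k"]) auto
  next
    fix x assume "x \<in> (\<lambda>k. a + (real k / real g) *\<^sub>R (b - a)) ` {..g}"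
    then obtain k where k: "k \<le> g" "x = a + (real k / real g) *\<^sub>R (b - a)" by auto
    have "(real k / real g) *\<^sub>R (b - a) \<in> M" using g by simp
    moreover have "x \<in> closed_segment a b"
      unfolding in_segment using k g(1)
      by (intro exI[of _ "real k / real g"]) (auto simp: algebra_simps)
    ultimately show "x \<in> closed_segment a b \<inter> M" using k lattice_add[OF M a] by blast
  qed
  moreover have "inj_on (\<lambda>k. a + (real k / real g) *\<^sub>R (b - a)) {..g}"
    using \<open>a \<noteq> b\<close> g(1) by (auto simp: inj_on_def)
  ultimately have "l = g"
    unfolding l_def edge_lattice_length_def by (simp add: card_image)
  then show "(1 / real l) *\<^sub>R (b - a) \<in> M" using g by auto
qed

section \<open>Lattice simplices from a basis, and their dilations\<close>

lemma lattice_simplex_basis: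
  fixes B :: "'a::euclidean_space set"
  assumes M: "full_rank_lattice M" and B: "independent B" "card B = DIM('a)"
    and f: "\<And>b. b \<in> B \<Longrightarrow> f b \<noteq> 0" "\<And>b. b \<in> B \<Longrightarrow> f b *\<^sub>R b \<in> M"
  shows "lattice_simplex M (convex hull (insert 0 ((\<lambda>b. f b *\<^sub>R b) ` B)))"
proof -
  have fin: "finite B" using B(1) by (rule finiteI_independent)
  let ?S = "(\<lambda>b. f b *\<^sub>R b) ` B"
  have inj: "inj_on (\<lambda>b. f b *\<^sub>R b) B"
  proof (rule inj_onI, rule ccontr)
    fix b c assume bc: "b \<in> B" "c \<in> B" "f b *\<^sub>R b = f c *\<^sub>R c" "b \<noteq> c"
    have "(\<Sum>x\<in>{b,c}. (if x = b then f b else - f c) *\<^sub>R x) = 0"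
      using bc by auto
    from independentD[OF B(1) _ _ this, of b] bc f(1) show False by auto
  qed
  have "independent ?S"
    unfolding independent_explicit
  proof (intro conjI allI impI ballI)
    fix u v assume u: "(\<Sum>x\<in>?S. u x *\<^sub>R x) = 0" and v: "v \<in> ?S"
    then have "(\<Sum>b\<in>B. (u (f b *\<^sub>R b) * f b) *\<^sub>R b) = 0"
      by (simp add: sum.reindex[OF inj])
    from independentD[OF B(1) fin order_refl this] v f(1) show "u v = 0" by auto
  qed (use fin in simp)
  then have "0 \<notin> ?S" by (metis dependent_zero)
  with \<open>independent ?S\<close> have "\<not> affine_dependent (insert 0 ?S)"
    by (simp add: affine_dependent_iff_dependent)
  moreover have "card (insert 0 ?S) = DIM('a) + 1"
    using fin \<open>0 \<notin> ?S\<close> B(2) by (simp add: card_image[OF inj])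
  ultimately have "int DIM('a) simplex (convex hull (insert 0 ?S))"
    by (intro simplex_convex_hull) auto
  moreover have "lattice_polytope M (convex hull (insert 0 ?S))"
    unfolding lattice_polytope_def using fin lattice_zero[OF M] f(2)
    by (intro exI[of _ "insert 0 ?S"]) auto
  ultimately show ?thesis unfolding lattice_simplex_def by blast
qed

definition lattice_dilation :: "'a::euclidean_space set \<Rightarrow> nat \<Rightarrow> 'a set \<Rightarrow> bool" where
  "lattice_dilation M k D \<longleftrightarrow>
     (\<exists>w s Q. w \<in> M \<and> k \<le> s \<and> lattice_simplex M Q \<and> D = (\<lambda>u. w + real s *\<^sub>R u) ` Q)"

text \<open>Lets a covering be built as a family of point sets; the translation, factor and simplex
  of each piece are chosen only here.\<close>

lemma covered_by_dilationsI:
  assumes "finite \<D>" "\<And>D. D \<in> \<D> \<Longrightarrow> lattice_dilation M k D" "P = \<Union>\<D>"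
  shows "covered_by_dilations M k P"
proof -
  have "\<forall>D\<in>\<D>. \<exists>t. case t of (w, s, Q) \<Rightarrow>
      w \<in> M \<and> k \<le> s \<and> lattice_simplex M Q \<and> D = (\<lambda>u. w + real s *\<^sub>R u) ` Q"
    using assms(2) unfolding lattice_dilation_def by auto
  from bchoice[OF this] obtain t where t: "\<forall>D\<in>\<D>. case t D of (w, s, Q) \<Rightarrow>
      w \<in> M \<and> k \<le> s \<and> lattice_simplex M Q \<and> D = (\<lambda>u. w + real s *\<^sub>R u) ` Q"
    by blast
  have "(case t D of (w, s, Q) \<Rightarrow> (\<lambda>u. w + real s *\<^sub>R u) ` Q) = D" if "D \<in> \<D>" for D
    using bspec[OF t that] by (auto split: prod.splits)
  then have "P = (\<Union>(w, s, Q)\<in>t ` \<D>. (\<lambda>u. w + real s *\<^sub>R u) ` Q)"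
    unfolding assms(3) image_image by simp
  moreover have "\<forall>(w, s, Q)\<in>t ` \<D>. w \<in> M \<and> k \<le> s \<and> lattice_simplex M Q"
  proof
    fix q assume "q \<in> t ` \<D>"
    then obtain D where "D \<in> \<D>" "q = t D" by blast
    then show "case q of (w, s, Q) \<Rightarrow> w \<in> M \<and> k \<le> s \<and> lattice_simplex M Q"
      using bspec[OF t, of D] by (auto split: prod.splits)
  qed
  ultimately show ?thesis
    unfolding covered_by_dilations_def using assms(1) by (intro exI[of _ "t ` \<D>"]) auto
qed

section \<open>Corners with rounded edge lengths\<close>

text \<open>The corner at \<^term>\<open>p\<close> spanned by the longest multiples of \<^term>\<open>s\<close> lattice steps
  that fit into the edges \<^term>\<open>b\<close> of lattice length \<^term>\<open>l b\<close>.\<close>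

definition corner :: "'a::real_vector set \<Rightarrow> ('a \<Rightarrow> nat) \<Rightarrow> nat \<Rightarrow> 'a \<Rightarrow> 'a set" where
  "corner B l s p =
     convex hull (insert p ((\<lambda>b. p + (real (s * (l b div s)) / real (l b)) *\<^sub>R b) ` B))"

text \<open>The relative loss of rounding an edge length down to a multiple of \<^term>\<open>s\<close>;
  meaningful only for \<^term>\<open>s \<le> l\<close>, since otherwise it is the junk value of a division by 0.\<close>

definition defect :: "nat \<Rightarrow> nat \<Rightarrow> real" where
  "defect s l = real (l mod s) / real (s * (l div s))"

text \<open>Reciprocal of the fraction of the edge that \<open>corner\<close> keeps, hence the
  factor by which a coordinate grows when measured along the shortened edge.\<close>

lemma one_plus_defect:
  assumes "0 < s" "s \<le> l"
  shows "1 + defect s l = real l / real (s * (l div s))"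
proof -
  define c where "c = real (s * (l div s))"
  have "real l = c + real (l mod s)"
    unfolding c_def by (metis mult_div_mod_eq of_nat_add)
  moreover have "c > 0" using assms by (simp add: c_def div_greater_zero_iff)
  ultimately show ?thesis unfolding defect_def c_def[symmetric] by (simp add: field_simps)
qed

lemma defect_le:
  assumes "0 < s" "0 < q" "q \<le> l div s" "l mod s \<le> m"
  shows "defect s l \<le> real m / real (s * q)"
  unfolding defect_def using assms by (intro frac_le) auto

text \<open>An edge of the corner at \<open>p\<close> consists of \<open>s * (l b div s)\<close>
  lattice steps. Dividing by \<open>s\<close> leaves \<open>l b div s\<close> whole steps, which is
  a lattice vector, nonzero since \<open>s \<le> l b\<close>.\<close>

lemma lattice_dilation_corner:
  fixes B :: "'a::euclidean_space set"
  assumes M: "full_rank_lattice M" and B: "independent B" "card B = DIM('a)"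
    and p: "p \<in> M" and s: "0 < s" "k \<le> s"
    and l: "\<And>b. b \<in> B \<Longrightarrow> s \<le> l b" "\<And>b. b \<in> B \<Longrightarrow> (1 / real (l b)) *\<^sub>R b \<in> M"
  shows "lattice_dilation M k (corner B l s p)"
proof -
  define f where "f b = real (l b div s) / real (l b)" for b
  define Q where "Q = convex hull (insert 0 ((\<lambda>b. f b *\<^sub>R b) ` B))"
  have "lattice_simplex M Q"
    unfolding Q_def
  proof (rule lattice_simplex_basis[OF M B])
    fix b assume b: "b \<in> B"
    show "f b \<noteq> 0" using l(1)[OF b] s(1) unfolding f_def by (simp add: div_greater_zero_iff)
    show "f b *\<^sub>R b \<in> M"
      using lattice_scale_nat[OF M l(2)[OF b], of "l b div s"] by (simp add: f_def)
  qed
  moreover have "corner B l s p = (\<lambda>u. p + real s *\<^sub>R u) ` Q"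
    unfolding corner_def Q_def convex_hull_affinity[symmetric]
    by (simp add: image_image f_def)
  ultimately show ?thesis unfolding lattice_dilation_def using p s(2) by blast
qed

lemma corner_subset:
  assumes "convex P" "p \<in> P"
    "\<And>b. b \<in> B \<Longrightarrow> p + (real (s * (l b div s)) / real (l b)) *\<^sub>R b \<in> P"
  shows "corner B l s p \<subseteq> P"
  unfolding corner_def using assms by (intro hull_minimal) auto

text \<open>The numbers \<open>y b * (1 + defect s (l b))\<close> are the barycentric coordinates of
  the point in the corner; the bound on their sum leaves a nonnegative weight for
  \<open>p\<close>.\<close>

lemma mem_corner:
  assumes B: "finite B" and s: "0 < s" "\<And>b. b \<in> B \<Longrightarrow> s \<le> l b"
    and y: "\<And>b. b \<in> B \<Longrightarrow> 0 \<le> y b" "(\<Sum>b\<in>B. y b * (1 + defect s (l b))) \<le> 1"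
  shows "p + (\<Sum>b\<in>B. y b *\<^sub>R b) \<in> corner B l s p"
proof -
  define r where "r b = real (s * (l b div s)) / real (l b)" for b
  have r: "r b > 0" "1 + defect s (l b) = 1 / r b" if "b \<in> B" for b
    using s(2)[OF that] s(1) one_plus_defect[OF s(1) s(2)[OF that]]
    by (auto simp: r_def div_greater_zero_iff)
  have corner: "corner B l s p = convex hull (insert p ((\<lambda>b. p + r b *\<^sub>R b) ` B))"
    unfolding corner_def r_def ..
  define a where "a i = (case i of None \<Rightarrow> 1 - (\<Sum>b\<in>B. y b / r b) | Some b \<Rightarrow> y b / r b)" for i
  define z where "z i = (case i of None \<Rightarrow> p | Some b \<Rightarrow> p + r b *\<^sub>R b)" for i
  let ?I = "insert None (Some ` B)"
  have sum_I: "sum g ?I = g None + (\<Sum>b\<in>B. g (Some b))" for g :: "'a option \<Rightarrow> 'b::comm_monoid_add"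
    using B by (subst sum.insert) (auto simp: sum.reindex)
  have "(\<Sum>b\<in>B. y b / r b) \<le> 1" using y(2) r(2) by simp
  then have "(\<Sum>i\<in>?I. a i *\<^sub>R z i) \<in> corner B l s p"
    using B y(1) r(1) unfolding corner
    by (intro convex_sum) (auto simp: a_def z_def sum_I less_imp_le hull_inc)
  also have "(\<Sum>i\<in>?I. a i *\<^sub>R z i) = p + (\<Sum>b\<in>B. (y b / r b) *\<^sub>R (r b *\<^sub>R b))"
    by (simp add: sum_I a_def z_def scaleR_add_right sum.distrib algebra_simps flip: scaleR_sum_left)
  also have "(\<Sum>b\<in>B. (y b / r b) *\<^sub>R (r b *\<^sub>R b)) = (\<Sum>b\<in>B. y b *\<^sub>R b)"
    using r(1) by (intro sum.cong) (auto simp: less_imp_neq[symmetric])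
  finally show ?thesis .
qed

text \<open>The maximality of the vertex coordinate x0 = \<open>1 - sum x B\<close> enters here:
  each \<open>x b\<close> is at most x0, so the total loss is at most x0 times the sum of the
  defects, hence at most x0, the mass that the vertex has to spare.\<close>

lemma sum_defect_le:
  fixes x :: "'b \<Rightarrow> real"
  assumes "finite B" "\<And>b. b \<in> B \<Longrightarrow> 0 \<le> x b" "\<And>b. b \<in> B \<Longrightarrow> x b \<le> 1 - sum x B"
    and "sum x B \<le> 1" "(\<Sum>b\<in>B. defect s (l b)) \<le> 1"
  shows "(\<Sum>b\<in>B. x b * (1 + defect s (l b))) \<le> 1"
proof -
  have "(\<Sum>b\<in>B. x b * defect s (l b)) \<le> (\<Sum>b\<in>B. (1 - sum x B) * defect s (l b))"
    using assms(3) by (intro sum_mono mult_right_mono) (auto simp: defect_def)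
  also have "\<dots> \<le> 1 - sum x B"
    using assms(4,5) by (simp add: mult_left_le flip: sum_distrib_left)
  finally show ?thesis by (simp add: distrib_left sum.distrib)
qed

section \<open>Arithmetic of the rounding losses\<close>

text \<open>\<open>defect 2\<close> is 0, 1/2 (length 3) or at most 1/4, so three values exceed 1
  only as 1/2 + 1/2 plus a positive term. Then two lengths are 3, with \<open>defect 3\<close> equal
  to 0, and the third has \<open>defect 3\<close> at most 2/3.\<close>

lemma defect_dim3:
  assumes "card B = 3" "\<And>b. b \<in> B \<Longrightarrow> 2 \<le> (l b :: nat)"
  obtains s where "s \<in> {2, 3}" "\<And>b. b \<in> B \<Longrightarrow> s \<le> l b" "(\<Sum>b\<in>B. defect s (l b)) \<le> 1"
proof -
  obtain a b c where B: "B = {a, b, c}" "a \<noteq> b" "a \<noteq> c" "b \<noteq> c"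
    using assms(1) by (auto simp: card_3_iff)
  have two: "defect 2 n = 0 \<or> n = 3 \<and> defect 2 n = 1 / 2 \<or> 5 \<le> n \<and> defect 2 n \<le> 1 / 4"
    if "2 \<le> n" for n
  proof -
    have "even n \<or> n = 3 \<or> odd n \<and> 5 \<le> n" using that by presburger
    then consider "even n" | "n = 3" | "odd n" "5 \<le> n" by blast
    then show ?thesis
    proof cases
      case 3
      then show ?thesis using defect_le[of 2 2 n 1] by simp
    qed (simp_all add: defect_def)
  qed
  have three: "defect 3 3 = 0" "3 \<le> n \<Longrightarrow> defect 3 n \<le> 2 / 3" for n
    using defect_le[of 3 1 n 2] by (auto simp: defect_def)
  have l: "2 \<le> l a" "2 \<le> l b" "2 \<le> l c" using assms(2) B(1) by auto
  have sums: "(\<Sum>x\<in>B. g x) = g a + g b + g c" for g :: "_ \<Rightarrow> real"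
    using B by simp
  show thesis
  proof (cases "(\<Sum>x\<in>B. defect 2 (l x)) \<le> 1")
    case True
    then show ?thesis using that[of 2] assms(2) by auto
  next
    case False
    then have not_two: "defect 2 (l a) + defect 2 (l b) + defect 2 (l c) > 1" unfolding sums by simp
    \<comment> \<open>Three terms of at most 1/2 with sum above 1 include no 0. This rules out
      length 2, so factor 3 is admissible.\<close>
    have h: "defect 2 n = 0 \<or> 3 \<le> n" "defect 2 n \<le> 1 / 2" if "2 \<le> n" for n
      using two[OF that] by auto
    have ge3: "3 \<le> l a" "3 \<le> l b" "3 \<le> l c"
      using not_two h(1)[OF l(1)] h(1)[OF l(2)] h(1)[OF l(3)]
        h(2)[OF l(1)] h(2)[OF l(2)] h(2)[OF l(3)] by auto
    have h: "defect 3 n = 0 \<or> defect 2 n \<le> 1 / 4 \<and> defect 3 n \<le> 2 / 3" "defect 2 n \<le> 1 / 2"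
      if "3 \<le> n" for n
      using two[of n] three(1) three(2)[OF that] that by auto
    have "defect 3 (l a) + defect 3 (l b) + defect 3 (l c) \<le> 1"
      using not_two h(1)[OF ge3(1)] h(1)[OF ge3(2)] h(1)[OF ge3(3)]
        h(2)[OF ge3(1)] h(2)[OF ge3(2)] h(2)[OF ge3(3)] by argo
    then show ?thesis using that[of 3] ge3 B(1) unfolding sums by auto
  qed
qed

text \<open>If factor 3 fails, the four values of \<open>defect 3\<close> sum to more than 1. In
  terms of the values 1/3 (lengths 4, 8), 2/9 (length 11) and at most 1/6, this takes at least two
  values 1/3. If factor 4 fails too, \<open>defect 4\<close> leaves only 4 or 8 twice, 11 and 7.
  Without the 7 the losses for factor 3 sum to 1/3 + 1/3 + 2/9 = 8/9.\<close>

lemma defect_dim4: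
  assumes "card B = 4" "\<And>b. b \<in> B \<Longrightarrow> 3 \<le> (l b :: nat)" "\<And>b. b \<in> B \<Longrightarrow> l b \<noteq> 5"
  obtains (dilation) s where "s \<in> {3, 4}" "\<And>b. b \<in> B \<Longrightarrow> s \<le> l b" "(\<Sum>b\<in>B. defect s (l b)) \<le> 1"
  | (exceptional) c where "c \<in> B" "l c = 7" "\<And>b. b \<in> B - {c} \<Longrightarrow> l b \<in> {4, 8, 11}"
      "(\<Sum>b\<in>B - {c}. defect 3 (l b)) \<le> 8 / 9"
proof -
  obtain a b c d where B: "B = {a, b, c, d}" and
    ne: "a \<noteq> b" "a \<noteq> c" "a \<noteq> d" "b \<noteq> c" "b \<noteq> d" "c \<noteq> d"
  proof -
    have "card B = Suc 3" using assms(1) by simp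
    then obtain a A where "B = insert a A" "a \<notin> A" "card A = 3"
      unfolding card_Suc_eq by blast
    then show thesis using that by (auto simp: card_3_iff)
  qed
  \<comment> \<open>The last alternative takes in 10 and all lengths from 12 on. Length 5 would have
    \<open>defect 3\<close> equal to 2/3, above the bound 1/3 that holds for all other
    lengths.\<close>
  have type: "defect 3 n = 0 \<or>
      (4 \<le> n \<and> (n \<in> {4, 8} \<and> defect 3 n = 1 / 3 \<and> defect 4 n = 0 \<or>
      n = 11 \<and> defect 3 n = 2 / 9 \<and> defect 4 n = 3 / 8 \<or>
      n = 7 \<and> defect 3 n = 1 / 6 \<and> defect 4 n = 3 / 4 \<or>
      defect 3 n \<le> 1 / 6 \<and> defect 4 n \<le> 1 / 4))"
    if "3 \<le> n" "n \<noteq> 5" for n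
  proof -
    have "n mod 3 = 0 \<or> n = 4 \<or> n = 8 \<or> n = 11 \<or> n = 7 \<or> n = 10 \<or> 12 \<le> n"
      using that by presburger
    then consider "n mod 3 = 0" | "n = 4" | "n = 8" | "n = 11" | "n = 7" | "n = 10" | "12 \<le> n"
      by (elim disjE)
    then show ?thesis
    proof cases
      case 7
      then have "defect 3 n \<le> real 2 / real (3 * 4)" "defect 4 n \<le> real 3 / real (4 * 3)"
        by (intro defect_le; simp)+
      with 7 show ?thesis by simp
    qed (simp_all add: defect_def)
  qed
  have le3: "defect 3 n \<le> 1 / 3" if "3 \<le> n" "n \<noteq> 5" for n
    using type[OF that] by auto
  note T = type[of "l a"] type[of "l b"] type[of "l c"] type[of "l d"]
  have l: "3 \<le> l a" "3 \<le> l b" "3 \<le> l c" "3 \<le> l d" "l a \<noteq> 5" "l b \<noteq> 5" "l c \<noteq> 5" "l d \<noteq> 5"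
    using assms(2,3) B by auto
  define f where "f n \<longleftrightarrow> n \<in> {4, 8, 11 :: nat}" for n
  let ?d = "\<lambda>s x. defect s (l x)"
  have main: "(l a = 7 \<and> f (l b) \<and> f (l c) \<and> f (l d) \<and> ?d 3 b + ?d 3 c + ?d 3 d \<le> 8 / 9 \<or>
      l b = 7 \<and> f (l a) \<and> f (l c) \<and> f (l d) \<and> ?d 3 a + ?d 3 c + ?d 3 d \<le> 8 / 9 \<or>
      l c = 7 \<and> f (l a) \<and> f (l b) \<and> f (l d) \<and> ?d 3 a + ?d 3 b + ?d 3 d \<le> 8 / 9 \<or>
      l d = 7 \<and> f (l a) \<and> f (l b) \<and> f (l c) \<and> ?d 3 a + ?d 3 b + ?d 3 c \<le> 8 / 9)"
    if three: "?d 3 a + ?d 3 b + ?d 3 c + ?d 3 d > 1"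
      and four: "4 \<le> l a \<and> 4 \<le> l b \<and> 4 \<le> l c \<and> 4 \<le> l d \<longrightarrow> ?d 4 a + ?d 4 b + ?d 4 c + ?d 4 d > 1"
  proof -
    \<comment> \<open>With the Boolean \<open>F\<close> for length 4, 8 or 11 and \<open>S\<close>
      for length 7, the case analysis becomes propositional logic over linear real arithmetic, which
      \<open>argo\<close> decides.\<close>
    define T where "T F S d3 d4 \<longleftrightarrow> F \<and> d3 = 1 / 3 \<and> d4 = 0 \<or> F \<and> d3 = 2 / 9 \<and> d4 = 3 / 8 \<or>
        S \<and> d3 = 1 / 6 \<and> d4 = 3 / 4 \<or> d3 \<le> 1 / 6 \<and> d4 \<le> 1 / 4" for F S and d3 d4 :: real
    have split: "sp \<and> fq \<and> fr \<and> ft \<and> q3 + r3 + t3 \<le> 8 / 9 \<or>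
        sq \<and> fp \<and> fr \<and> ft \<and> p3 + r3 + t3 \<le> 8 / 9 \<or>
        sr \<and> fp \<and> fq \<and> ft \<and> p3 + q3 + t3 \<le> 8 / 9 \<or>
        st \<and> fp \<and> fq \<and> fr \<and> p3 + q3 + r3 \<le> 8 / 9"
      if "T fp sp p3 p4" "T fq sq q3 q4" "T fr sr r3 r4" "T ft st t3 t4"
        "p3 + q3 + r3 + t3 > 1" "p4 + q4 + r4 + t4 > 1"
      for fp sp fq sq fr sr ft st p3 q3 r3 t3 p4 q4 r4 t4
      using that unfolding T_def by argo
    \<comment> \<open>Four terms of at most 1/3 with sum above 1 include no 0. This rules out length
      3, so factor 4 is admissible.\<close>
    have "?d 3 a \<noteq> 0" "?d 3 b \<noteq> 0" "?d 3 c \<noteq> 0" "?d 3 d \<noteq> 0"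
      using three le3[OF l(1,5)] le3[OF l(2,6)] le3[OF l(3,7)] le3[OF l(4,8)] by linarith+
    then have ge4: "4 \<le> l a" "4 \<le> l b" "4 \<le> l c" "4 \<le> l d"
      and "T (f (l a)) (l a = 7) (?d 3 a) (?d 4 a)" "T (f (l b)) (l b = 7) (?d 3 b) (?d 4 b)"
      "T (f (l c)) (l c = 7) (?d 3 c) (?d 4 c)" "T (f (l d)) (l d = 7) (?d 3 d) (?d 4 d)"
      using type[OF l(1,5)] type[OF l(2,6)] type[OF l(3,7)] type[OF l(4,8)]
      unfolding T_def f_def by auto
    with split[OF _ _ _ _ three] four show ?thesis by blast
  qed
  have sums: "(\<Sum>x\<in>B. g x) = g a + g b + g c + g d"
    "(\<Sum>x\<in>B - {a}. g x) = g b + g c + g d" "(\<Sum>x\<in>B - {b}. g x) = g a + g c + g d"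
    "(\<Sum>x\<in>B - {c}. g x) = g a + g b + g d" "(\<Sum>x\<in>B - {d}. g x) = g a + g b + g c"
    for g :: "_ \<Rightarrow> real"
    using ne unfolding B by (simp_all add: insert_Diff_if)
  have balls: "a \<in> B" "b \<in> B" "c \<in> B" "d \<in> B" "(\<forall>x\<in>B. Q x) \<longleftrightarrow> Q a \<and> Q b \<and> Q c \<and> Q d"
    "(\<forall>x\<in>B - {a}. Q x) \<longleftrightarrow> Q b \<and> Q c \<and> Q d" "(\<forall>x\<in>B - {b}. Q x) \<longleftrightarrow> Q a \<and> Q c \<and> Q d"
    "(\<forall>x\<in>B - {c}. Q x) \<longleftrightarrow> Q a \<and> Q b \<and> Q d" "(\<forall>x\<in>B - {d}. Q x) \<longleftrightarrow> Q a \<and> Q b \<and> Q c"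
    for Q
    using ne unfolding B by auto
  show thesis
  proof (cases "(\<Sum>x\<in>B. ?d 3 x) \<le> 1 \<or> (\<forall>x\<in>B. 4 \<le> l x) \<and> (\<Sum>x\<in>B. ?d 4 x) \<le> 1")
    case True
    then show ?thesis using dilation[of 3] dilation[of 4] assms(2) by auto
  next
    case False
    then have "?d 3 a + ?d 3 b + ?d 3 c + ?d 3 d > 1"
      "4 \<le> l a \<and> 4 \<le> l b \<and> 4 \<le> l c \<and> 4 \<le> l d \<longrightarrow> ?d 4 a + ?d 4 b + ?d 4 c + ?d 4 d > 1"
      unfolding sums balls by linarith+
    from main[OF this] show ?thesis
      using exceptional[of a] exceptional[of b] exceptional[of c] exceptional[of d]
      unfolding sums f_def using balls(1-4) B ne by auto
  qed
qed

section \<open>Covering the region of one vertex\<close>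

text \<open>The points at which the barycentric coordinate of the vertex \<^term>\<open>v\<close>, namely
  \<^term>\<open>1 - sum x B\<close>, is largest; \<^term>\<open>B\<close> consists of the edge vectors at \<^term>\<open>v\<close>.\<close>

definition vertex_region_covered ::
    "'a::euclidean_space set \<Rightarrow> nat \<Rightarrow> 'a set \<Rightarrow> 'a \<Rightarrow> 'a set \<Rightarrow> bool" where
  "vertex_region_covered M k P v B \<longleftrightarrow>
     (\<exists>\<D>. finite \<D> \<and> (\<forall>D\<in>\<D>. lattice_dilation M k D \<and> D \<subseteq> P) \<and>
       (\<forall>x. (\<forall>b\<in>B. 0 \<le> x b \<and> x b \<le> 1 - sum x B) \<and> sum x B \<le> 1
          \<longrightarrow> v + (\<Sum>b\<in>B. x b *\<^sub>R b) \<in> \<Union>\<D>))"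

lemma convex_triangle:
  assumes "convex P" "v \<in> P" "v + b \<in> P" "v + c \<in> P" "0 \<le> s" "0 \<le> t" "s + t \<le> 1"
  shows "v + s *\<^sub>R b + t *\<^sub>R c \<in> P"
proof -
  have "v + s *\<^sub>R b + t *\<^sub>R c = (1 - s - t) *\<^sub>R v + s *\<^sub>R (v + b) + t *\<^sub>R (v + c)"
    by (simp add: algebra_simps)
  also have "\<dots> \<in> convex hull {v, v + b, v + c}"
    unfolding convex_hull_3 using assms(5-7)
    by (intro CollectI exI[of _ "1 - s - t"] exI[of _ s] exI[of _ t] conjI refl) auto
  also have "\<dots> \<subseteq> P" using assms(1-4) by (intro hull_minimal) auto
  finally show ?thesis .
qed

lemma corner_ratio_le_1: "real (s * (n div s)) / real n \<le> 1"
proof -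
  have "real (s * (n div s)) \<le> real n" by (simp only: of_nat_le_iff times_div_less_eq_dividend)
  then show ?thesis by (simp add: divide_le_eq)
qed

lemma corner_vertex_subset:
  assumes "convex P" "v \<in> P" "\<And>b. b \<in> B \<Longrightarrow> v + b \<in> P"
  shows "corner B l s v \<subseteq> P"
proof (rule corner_subset[OF assms(1,2)])
  fix b assume "b \<in> B"
  then show "v + (real (s * (l b div s)) / real (l b)) *\<^sub>R b \<in> P"
    using convex_triangle[OF assms(1,2) assms(3) assms(3), of b b _ 0] corner_ratio_le_1[of s "l b"]
    by simp
qed

lemma vertex_region_covered_by_corner:
  fixes B :: "'a::euclidean_space set"
  assumes M: "full_rank_lattice M" and B: "independent B" "card B = DIM('a)"
    and P: "convex P" "v \<in> P" "\<And>b. b \<in> B \<Longrightarrow> v + b \<in> P" and v: "v \<in> M"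
    and l: "\<And>b. b \<in> B \<Longrightarrow> (1 / real (l b)) *\<^sub>R b \<in> M"
    and s: "0 < s" "k \<le> s" "\<And>b. b \<in> B \<Longrightarrow> s \<le> l b" "(\<Sum>b\<in>B. defect s (l b)) \<le> 1"
  shows "vertex_region_covered M k P v B"
  unfolding vertex_region_covered_def
proof (intro exI[of _ "{corner B l s v}"] conjI allI impI)
  have fin: "finite B" using B(1) by (rule finiteI_independent)
  show "\<forall>D\<in>{corner B l s v}. lattice_dilation M k D \<and> D \<subseteq> P"
    using lattice_dilation_corner[OF M B v s(1,2,3) l] corner_vertex_subset[OF P] by simp
  fix x :: "'a \<Rightarrow> real" assume "(\<forall>b\<in>B. 0 \<le> x b \<and> x b \<le> 1 - sum x B) \<and> sum x B \<le> 1"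
  then show "v + (\<Sum>b\<in>B. x b *\<^sub>R b) \<in> \<Union>{corner B l s v}"
    using mem_corner[OF fin s(1) s(3)] sum_defect_le[OF fin _ _ _ s(4)] by simp
qed simp

text \<open>For lengths such as 4, 4, 11, 7 the defects sum to more than 1 both for factor 3 and for factor 4.
  The corner of factor 3 then misses points only where the coordinate on the edge of length 7 is at
  least 1/7, and these lie in its translate by one lattice step along that edge.\<close>

lemma vertex_region_covered_exceptional:
  fixes B :: "'a::euclidean_space set"
  assumes M: "full_rank_lattice M" and B: "independent B" "card B = DIM('a)" and dim: "DIM('a) = 4"
    and P: "convex P" "v \<in> P" "\<And>b. b \<in> B \<Longrightarrow> v + b \<in> P" and v: "v \<in> M"
    and l: "\<And>b. b \<in> B \<Longrightarrow> (1 / real (l b)) *\<^sub>R b \<in> M"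
    and c: "c \<in> B" "l c = 7" "\<And>b. b \<in> B - {c} \<Longrightarrow> l b \<in> {4, 8, 11}"
      "(\<Sum>b\<in>B - {c}. defect 3 (l b)) \<le> 8 / 9"
  shows "vertex_region_covered M 3 P v B"
proof -
  define p where "p = v + (1 / 7) *\<^sub>R c"
  let ?C = "corner B l 3 v" and ?T = "corner B l 3 p"
  have fin: "finite B" using B(1) by (rule finiteI_independent)
  have l3: "3 \<le> l b" if "b \<in> B" for b using c(2) c(3)[of b] that by (cases "b = c") auto
  have dc: "defect 3 (l c) = 1 / 6" by (simp add: c(2) defect_def)
  have "p \<in> M" unfolding p_def using lattice_add[OF M v l[OF c(1)]] c(2) by simp
  have dilations: "\<forall>D\<in>{?C, ?T}. lattice_dilation M 3 D"
    using lattice_dilation_corner[OF M B _ _ _ l3 l, of _ 3] v \<open>p \<in> M\<close> by simp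
  have "?T \<subseteq> P"
  proof (rule corner_subset[OF P(1)])
    show "p \<in> P"
      unfolding p_def using convex_triangle[OF P(1,2) P(3)[OF c(1)] P(3)[OF c(1)], of "1/7" 0] by simp
    fix b assume b: "b \<in> B"
    show "p + (real (3 * (l b div 3)) / real (l b)) *\<^sub>R b \<in> P"
    \<comment> \<open>Along \<open>c\<close> the corner keeps 6/7 of the edge, so the translate ends
      exactly at \<open>v + c\<close>. On the other edges it keeps 3/4 or 9/11, and adding 1/7 stays
      below 1.\<close>
    proof (cases "b = c")
      case True
      then show ?thesis
        using P(3)[OF c(1)] by (simp add: p_def c(2) add.assoc flip: scaleR_add_left)
    next
      case False
      then have "1 / 7 + real (3 * (l b div 3)) / real (l b) \<le> 1" using c(3)[of b] b by auto
      then show ?thesis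
        unfolding p_def by (intro convex_triangle[OF P(1,2) P(3)[OF c(1)] P(3)[OF b]]) auto
    qed
  qed
  moreover have "?C \<subseteq> P" by (rule corner_vertex_subset[OF P])
  moreover have "v + (\<Sum>b\<in>B. x b *\<^sub>R b) \<in> \<Union>{?C, ?T}"
    if x: "\<forall>b\<in>B. 0 \<le> x b \<and> x b \<le> 1 - sum x B" "sum x B \<le> 1" for x :: "'a \<Rightarrow> real"
  proof -
    let ?x0 = "1 - sum x B"
    have "(\<Sum>b\<in>B - {c}. x b * defect 3 (l b)) \<le> (\<Sum>b\<in>B - {c}. ?x0 * defect 3 (l b))"
      using x(1) by (intro sum_mono mult_right_mono) (auto simp: defect_def)
    also have "\<dots> \<le> ?x0 * (8 / 9)"
      unfolding sum_distrib_left[symmetric] using c(4) x(2) by (intro mult_left_mono) auto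
    \<comment> \<open>The right-hand side equals 1 - \<open>?x0 / 9\<close> +
      \<open>x c / 6\<close>, so the corner at \<open>v\<close> can miss the point only if
      \<open>x c\<close> exceeds 2/3 of \<open>?x0\<close>.\<close>
    finally have sum_le: "(\<Sum>b\<in>B. x b * (1 + defect 3 (l b))) \<le> sum x B + ?x0 * (8 / 9) + x c / 6"
      using sum.remove[OF fin c(1), of "\<lambda>b. x b * defect 3 (l b)"]
      by (simp add: distrib_left sum.distrib dc)
    have x_c: "x c \<le> ?x0" using x(1) c(1) by blast
    have x_nonneg: "0 \<le> sum x B" using x(1) by (intro sum_nonneg) blast
    show ?thesis
    proof (cases "x c < 1 / 7")
      case True
      have "sum x (B - {c}) \<le> (\<Sum>b\<in>B - {c}. ?x0)" using x(1) by (intro sum_mono) auto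
      also have "\<dots> = 3 * ?x0" using c(1) B(2) dim by simp
      finally have "1 - x c \<le> 4 * ?x0" using sum.remove[OF fin c(1), of x] by simp
      \<comment> \<open>Here \<open>?x0\<close> exceeds (1 - 1/7) / 4 = 3/14, so
        \<open>x c / 6\<close> < 1/42 < \<open>?x0 / 9\<close>.\<close>
      then have "(\<Sum>b\<in>B. x b * (1 + defect 3 (l b))) \<le> 1"
        using sum_le True by argo
      then show ?thesis using mem_corner[OF fin _ l3, where y = x and p = v] x(1) by auto
    next
      case False
      \<comment> \<open>Coordinates relative to \<open>p\<close>. Removing 1/7 at weight 1 + 1/6
        saves 1/6, which compensates the excess \<open>x c / 6\<close> because \<open>x c\<close> is
        at most \<open>?x0\<close> and hence at most 1.\<close>
      define y where "y b = (if b = c then x c - 1 / 7 else x b)" for b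
      have "(\<Sum>b\<in>B - {c}. y b * (1 + defect 3 (l b))) = (\<Sum>b\<in>B - {c}. x b * (1 + defect 3 (l b)))"
        by (rule sum.cong) (auto simp: y_def)
      moreover have "y c = x c - 1 / 7" by (simp add: y_def)
      ultimately have "(\<Sum>b\<in>B. y b * (1 + defect 3 (l b))) = (\<Sum>b\<in>B. x b * (1 + defect 3 (l b))) - 1 / 6"
        using sum.remove[OF fin c(1), of "\<lambda>b. x b * (1 + defect 3 (l b))"]
          sum.remove[OF fin c(1), of "\<lambda>b. y b * (1 + defect 3 (l b))"]
        unfolding dc by argo
      also have "\<dots> \<le> 1" using sum_le x_c x_nonneg by argo
      finally have "p + (\<Sum>b\<in>B. y b *\<^sub>R b) \<in> ?T"
        using False x(1) by (intro mem_corner[OF fin _ l3]) (auto simp: y_def)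
      also have "p + (\<Sum>b\<in>B. y b *\<^sub>R b) = v + (\<Sum>b\<in>B. x b *\<^sub>R b)"
        using sum.remove[OF fin c(1), of "\<lambda>b. x b *\<^sub>R b"] sum.remove[OF fin c(1), of "\<lambda>b. y b *\<^sub>R b"]
        by (simp add: y_def p_def algebra_simps)
      finally show ?thesis by blast
    qed
  qed
  ultimately show ?thesis
    unfolding vertex_region_covered_def using dilations
    by (intro exI[of _ "{?C, ?T}"] conjI) simp_all
qed

section \<open>From the vertex regions to the whole simplex\<close>

lemma covered_by_vertex_regions:
  fixes V :: "'a::euclidean_space set"
  assumes V: "finite V" and "V \<noteq> {}"
    and cov: "\<And>v. v \<in> V \<Longrightarrow> vertex_region_covered M k (convex hull V) v ((\<lambda>w. w - v) ` (V - {v}))"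
  shows "covered_by_dilations M k (convex hull V)"
proof -
  let ?B = "\<lambda>v. (\<lambda>w. w - v) ` (V - {v})"
  let ?R = "\<lambda>v \<D>. finite \<D> \<and> (\<forall>D\<in>\<D>. lattice_dilation M k D \<and> D \<subseteq> convex hull V) \<and>
      (\<forall>x. (\<forall>b\<in>?B v. 0 \<le> x b \<and> x b \<le> 1 - sum x (?B v)) \<and> sum x (?B v) \<le> 1
          \<longrightarrow> v + (\<Sum>b\<in>?B v. x b *\<^sub>R b) \<in> \<Union>\<D>)"
  have "\<forall>v\<in>V. \<exists>\<D>. ?R v \<D>"
    by (rule ballI) (rule cov[unfolded vertex_region_covered_def])
  then have "\<exists>\<D>. \<forall>v\<in>V. ?R v (\<D> v)" by (rule bchoice)
  then obtain \<D> where R: "\<forall>v\<in>V. ?R v (\<D> v)" ..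
  have \<D>: "finite (\<D> v)" "D \<in> \<D> v \<Longrightarrow> lattice_dilation M k D" "D \<in> \<D> v \<Longrightarrow> D \<subseteq> convex hull V"
    if "v \<in> V" for v D
    using bspec[OF R that] by simp_all
  have reg: "v + (\<Sum>b\<in>?B v. x b *\<^sub>R b) \<in> \<Union>(\<D> v)"
    if "v \<in> V" "\<forall>b\<in>?B v. 0 \<le> x b \<and> x b \<le> 1 - sum x (?B v)" "sum x (?B v) \<le> 1" for v x
    by (rule mp[OF spec[OF conjunct2[OF conjunct2[OF bspec[OF R that(1)]]], of x] conjI[OF that(2,3)]])
  have "convex hull V = \<Union>(\<Union>(\<D> ` V))"
  proof
    show "\<Union>(\<Union>(\<D> ` V)) \<subseteq> convex hull V" using \<D>(3) by blast
    show "convex hull V \<subseteq> \<Union>(\<Union>(\<D> ` V))"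
    proof
      fix p assume "p \<in> convex hull V"
      then obtain c where c: "\<And>w. w \<in> V \<Longrightarrow> 0 \<le> c w" "sum c V = 1" "(\<Sum>w\<in>V. c w *\<^sub>R w) = p"
        unfolding convex_hull_finite[OF V] by auto
      have "Max (c ` V) \<in> c ` V" using V \<open>V \<noteq> {}\<close> by simp
      then obtain v where v: "v \<in> V" "c v = Max (c ` V)" by auto
      have max: "c w \<le> c v" if "w \<in> V" for w using that V v(2) by simp
      \<comment> \<open>Moves the coefficient of the vertex \<open>v + b\<close> to the edge vector
        \<open>b\<close>. Since these sum to \<open>1 - c v\<close>, the maximality of
        \<open>c v\<close> is the condition defining the region of \<open>v\<close>.\<close>
      define x where "x b = c (v + b)" for b
      have inj: "inj_on (\<lambda>w. w - v) (V - {v})" by (simp add: inj_on_def)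
      have "sum x (?B v) = sum c (V - {v})" by (simp add: sum.reindex[OF inj] x_def)
      also have "\<dots> = 1 - c v" using sum.remove[OF V v(1), of c] c(2) by simp
      finally have sum_x: "sum x (?B v) = 1 - c v" .
      have "v + (\<Sum>b\<in>?B v. x b *\<^sub>R b) = v + (\<Sum>w\<in>V - {v}. c w *\<^sub>R (w - v))"
        by (simp add: sum.reindex[OF inj] x_def)
      also have "\<dots> = v + (\<Sum>w\<in>V. c w *\<^sub>R (w - v))"
        by (simp add: sum.remove[OF V v(1)])
      also have "\<dots> = p"
        using c(2,3) by (simp add: scaleR_diff_right sum_subtractf flip: scaleR_sum_left)
      finally have "v + (\<Sum>b\<in>?B v. x b *\<^sub>R b) = p" .
      moreover have "v + (\<Sum>b\<in>?B v. x b *\<^sub>R b) \<in> \<Union>(\<D> v)"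
        using c(1) max v(1) by (intro reg) (auto simp: sum_x, auto simp: x_def)
      ultimately show "p \<in> \<Union>(\<Union>(\<D> ` V))" using v(1) by blast
    qed
  qed
  then show ?thesis
    using \<D>(1,2) V by (intro covered_by_dilationsI[of "\<Union>(\<D> ` V)"]) auto
qed

text \<open>Every subset of an affinely independent set spans a face of its hull.\<close>

lemma segment_edge_of_simplex:
  fixes V :: "'a::euclidean_space set"
  assumes "\<not> affine_dependent V" "a \<in> V" "b \<in> V" "a \<noteq> b"
  shows "closed_segment a b edge_of convex hull V"
  unfolding edge_of_def segment_convex_hull
proof
  have "{a, b} \<subseteq> V" using assms(2,3) by simp
  then show "convex hull {a, b} face_of convex hull V"
    unfolding face_of_convex_hull_affine_independent[OF assms(1)] by blast
  show "aff_dim (convex hull {a, b}) = 1" using assms(4) by (simp add: aff_dim_convex_hull)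
qed

text \<open>A polytope has finitely many faces, so the \<open>Min\<close> in
  \<open>lattice_length\<close> is a genuine minimum.\<close>

lemma lattice_length_le:
  assumes "polytope P" "e edge_of P"
  shows "lattice_length M P \<le> edge_lattice_length M e"
proof -
  have "finite {e. e edge_of P}"
    using finite_polytope_faces[OF assms(1)] by (rule rev_finite_subset) (auto simp: edge_of_def)
  then show ?thesis unfolding lattice_length_def using assms(2) by (intro Min_le) auto
qed

text \<open>\<open>simplex\<close> yields affinely independent vertices,
  \<open>lattice_polytope\<close> yields generators in \<open>M\<close>. The vertices are extreme
  points, hence among any generators.\<close>

lemma vertices_of_lattice_simplex:
  assumes "lattice_simplex M P"
  obtains V where "finite V" "V \<subseteq> M" "\<not> affine_dependent V" "card V = DIM('a) + 1"
    "P = convex hull (V :: 'a::euclidean_space set)"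
proof -
  obtain V where V: "finite V" "\<not> affine_dependent V" "int (card V) = int DIM('a) + 1"
    "P = convex hull V"
    using assms unfolding lattice_simplex_def simplex by blast
  obtain U where U: "U \<subseteq> M" "P = convex hull U"
    using assms unfolding lattice_simplex_def lattice_polytope_def by blast
  have "V \<subseteq> U"
    using extreme_point_of_convex_hull_affine_independent[OF V(2)] extreme_point_of_convex_hull[of _ U]
    unfolding V(4)[symmetric] U(2)[symmetric] by blast
  then have "V \<subseteq> M" using U(1) by (rule order_trans)
  then show thesis using that V by simp
qed

section \<open>The covering theorem in dimensions 3 and 4\<close>

theorem theorem1p1:
  fixes M P :: "'a::euclidean_space set"
  assumes "full_rank_lattice M"
    and "lattice_simplex M P"
  shows "(DIM('a) = 3 \<and> lattice_length M P \<ge> 2 \<longrightarrow> covered_by_dilations M 2 P) \<and>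
         (DIM('a) = 4 \<and> lattice_length M P \<ge> 3 \<and>
            (\<forall>e. e edge_of P \<longrightarrow> edge_lattice_length M e \<noteq> 5)
          \<longrightarrow> covered_by_dilations M 3 P)"
proof -
  note M = assms(1)
  obtain V where V: "finite V" "V \<subseteq> M" "\<not> affine_dependent V" "card V = DIM('a) + 1"
    and P: "P = convex hull V"
    using vertices_of_lattice_simplex[OF assms(2)] .
  have "V \<noteq> {}" using V(4) by auto
  have "polytope P" unfolding P using V(1) by (rule polytope_convex_hull)
  define B where "B v = (\<lambda>w. w - v) ` (V - {v})" for v
  define l where "l v b = edge_lattice_length M (closed_segment v (v + b))" for v b
  have B: "independent (B v)" "card (B v) = DIM('a)" if "v \<in> V" for v
    using V(3) affine_dependent_iff_dependent2[OF that] V(1,4) that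
    by (auto simp: B_def card_image inj_on_def)
  have inP: "v \<in> P" "\<And>b. b \<in> B v \<Longrightarrow> v + b \<in> P" if "v \<in> V" for v
    using that unfolding P B_def by (auto intro: hull_inc)
  have edge: "closed_segment v (v + b) edge_of P" if "v \<in> V" "b \<in> B v" for v b
    unfolding P using that by (intro segment_edge_of_simplex[OF V(3)]) (auto simp: B_def)
  have l: "lattice_length M P \<le> l v b" "(1 / real (l v b)) *\<^sub>R b \<in> M"
    if "v \<in> V" "b \<in> B v" for v b
  proof -
    have "v \<in> M" "v + b \<in> M" "v \<noteq> v + b" using that V(2) by (auto simp: B_def)
    from segment_lattice_length[OF M this] show "(1 / real (l v b)) *\<^sub>R b \<in> M"
      by (simp add: l_def)
    show "lattice_length M P \<le> l v b"
      unfolding l_def by (rule lattice_length_le[OF \<open>polytope P\<close> edge[OF that]])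
  qed
  have covered: "covered_by_dilations M k P" if "\<And>v. v \<in> V \<Longrightarrow> vertex_region_covered M k P v (B v)" for k
    using covered_by_vertex_regions[OF V(1) \<open>V \<noteq> {}\<close>] that unfolding P B_def by blast
  have "convex P" using \<open>polytope P\<close> by (rule polytope_imp_convex)
  show ?thesis
  proof (intro conjI impI; elim conjE)
    assume dim: "DIM('a) = 3" and len: "2 \<le> lattice_length M P"
    show "covered_by_dilations M 2 P"
    proof (rule covered)
      fix v assume v: "v \<in> V"
      have len_v: "card (B v) = 3" "\<And>b. b \<in> B v \<Longrightarrow> 2 \<le> l v b"
        using B(2)[OF v] dim order_trans[OF len l(1)[OF v]] by auto
      show "vertex_region_covered M 2 P v (B v)"
      proof (rule defect_dim3[OF len_v])
        fix s assume "s \<in> {2, 3}" "\<And>b. b \<in> B v \<Longrightarrow> s \<le> l v b" "(\<Sum>b\<in>B v. defect s (l v b)) \<le> 1"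
        then show ?thesis
          by (intro vertex_region_covered_by_corner
              [OF M B[OF v] \<open>convex P\<close> inP[OF v] subsetD[OF V(2) v] l(2)[OF v], where s = s]) auto
      qed
    qed
  next
    assume dim: "DIM('a) = 4" and len: "3 \<le> lattice_length M P"
      and no5: "\<forall>e. e edge_of P \<longrightarrow> edge_lattice_length M e \<noteq> 5"
    show "covered_by_dilations M 3 P"
    proof (rule covered)
      fix v assume v: "v \<in> V"
      \<comment> \<open>Each \<open>l v b\<close> is the lattice length of an edge of
        \<open>P\<close>, so the lower bound and the exclusion of 5 carry over to it.\<close>
      have len_v: "card (B v) = 4" "\<And>b. b \<in> B v \<Longrightarrow> 3 \<le> l v b" "\<And>b. b \<in> B v \<Longrightarrow> l v b \<noteq> 5"
        using B(2)[OF v] dim order_trans[OF len l(1)[OF v]] no5 edge[OF v] by (auto simp: l_def)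
      show "vertex_region_covered M 3 P v (B v)"
      proof (rule defect_dim4[OF len_v])
        fix s assume "s \<in> {3, 4}" "\<And>b. b \<in> B v \<Longrightarrow> s \<le> l v b" "(\<Sum>b\<in>B v. defect s (l v b)) \<le> 1"
        then show ?thesis
          by (intro vertex_region_covered_by_corner
              [OF M B[OF v] \<open>convex P\<close> inP[OF v] subsetD[OF V(2) v] l(2)[OF v], where s = s]) auto
      next
        fix c assume "c \<in> B v" "l v c = 7" "\<And>b. b \<in> B v - {c} \<Longrightarrow> l v b \<in> {4, 8, 11}"
          "(\<Sum>b\<in>B v - {c}. defect 3 (l v b)) \<le> 8 / 9"
        then show ?thesis
          by (intro vertex_region_covered_exceptional
              [OF M B[OF v] dim \<open>convex P\<close> inP[OF v] subsetD[OF V(2) v] l(2)[OF v]])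
      qed
    qed
  qed
qed

end
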